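(* The set of polynomial sequences, i.e. sequences $(p(n))_{n\in\mathbb N}$ where $p(n)=a_0+a_1n+\dots+a_kn^k$ is a polynomial with real coefficients, with termwise addition and multiplication, equality $=_{\mathcal F}$ and strict order $<_{\mathcal F}$, forms a non-Archimedean linearly ordered integral domain.
   Context: For sequences $(a_n),(b_n)\in\mathbb R^{\mathbb N}$: $(a_n)+(b_n)=(a_n+b_n)$ and $(a_n)\cdot(b_n)=(a_nb_n)$; $(a_n)=_{\mathcal F}(b_n)$ iff there is $m\in\mathbb N$ such that $a_n=b_n$ for all $n>m$; $(a_n)<_{\mathcal F}(b_n)$ iff there is $m\in\mathbb N$ such that $a_n<b_n$ for all $n>m$. Sequences are identified when they are $=_{\mathcal F}$-equal. An integral domain is a commutative ring in which there are no non-zero divisors of zero. "Linearly ordered" refers to the strict order $<_{\mathcal F}$ being total (any two elements are either $=_{\mathcal F}$-equal or comparable) and compatible with the ring operations in the usual sense of ordered rings. "Non-Archimedean" means that there are elements $a,b$ with $0<_{\mathcal F}a$ such that $k\cdot a<_{\mathcal F}b$ for every $k\in\mathbb N$. *)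

theory Defs
  imports "HOL-Algebra.Ring" "HOL-Computational_Algebra.Polynomial" Complex_Main
begin

definition eqF :: "(nat \<Rightarrow> real) \<Rightarrow> (nat \<Rightarrow> real) \<Rightarrow> bool" (infix "=\<^sub>F" 50)
  where "a =\<^sub>F b \<longleftrightarrow> (\<exists>m. \<forall>n>m. a n = b n)"

definition lessF :: "(nat \<Rightarrow> real) \<Rightarrow> (nat \<Rightarrow> real) \<Rightarrow> bool" (infix "<\<^sub>F" 50)
  where "a <\<^sub>F b \<longleftrightarrow> (\<exists>m. \<forall>n>m. a n < b n)"

definition eqF_rel :: "((nat \<Rightarrow> real) \<times> (nat \<Rightarrow> real)) set"
  where "eqF_rel = {(a, b). a =\<^sub>F b}"

lemma equiv_eqF_rel: "equiv UNIV eqF_rel"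
proof (rule equivI)
  show "refl eqF_rel" by (auto simp: refl_on_def eqF_rel_def eqF_def)
  show "sym eqF_rel" by (force simp: sym_def eqF_rel_def eqF_def)
  show "trans eqF_rel"
  proof (rule transI)
    fix a b c assume "(a, b) \<in> eqF_rel" "(b, c) \<in> eqF_rel"
    then obtain m k where "\<forall>n>m. a n = b n" "\<forall>n>k. b n = c n"
      by (auto simp: eqF_rel_def eqF_def)
    then have "\<forall>n>max m k. a n = c n" by auto
    then show "(a, c) \<in> eqF_rel" unfolding eqF_rel_def eqF_def by blast
  qed
qed auto

definition poly_seqs :: "(nat \<Rightarrow> real) set"
  where "poly_seqs = range (\<lambda>p n. poly p (real n))"

text \<open>
  Identification of \<open>=\<^sub>F\<close>-equal sequences is expressed by passing to equivalence classes
  with respect to \<^const>\<open>eqF_rel\<close>; the classes are taken in the set of all real sequences.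
  The operations and the order on classes are given by arbitrary representatives; the lemmas
  below show that the choice does not matter.
\<close>

definition class_add :: "(nat \<Rightarrow> real) set \<Rightarrow> (nat \<Rightarrow> real) set \<Rightarrow> (nat \<Rightarrow> real) set"
  where "class_add A B = (\<Union>a\<in>A. \<Union>b\<in>B. eqF_rel `` {\<lambda>n. a n + b n})"

definition class_mult :: "(nat \<Rightarrow> real) set \<Rightarrow> (nat \<Rightarrow> real) set \<Rightarrow> (nat \<Rightarrow> real) set"
  where "class_mult A B = (\<Union>a\<in>A. \<Union>b\<in>B. eqF_rel `` {\<lambda>n. a n * b n})"

definition class_less :: "(nat \<Rightarrow> real) set \<Rightarrow> (nat \<Rightarrow> real) set \<Rightarrow> bool"
  where "class_less A B \<longleftrightarrow> (\<exists>a\<in>A. \<exists>b\<in>B. a <\<^sub>F b)"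

lemma class_add_class:
  "class_add (eqF_rel `` {a}) (eqF_rel `` {b}) = eqF_rel `` {\<lambda>n. a n + b n}"
  unfolding class_add_def
proof (rule UN_equiv_class2[OF equiv_eqF_rel equiv_eqF_rel])
  show "congruent2 eqF_rel eqF_rel (\<lambda>a b. eqF_rel `` {\<lambda>n. a n + b n})"
  proof (rule congruent2I')
    fix a a' b b' assume "(a, a') \<in> eqF_rel" "(b, b') \<in> eqF_rel"
    then obtain m k where "\<forall>n>m. a n = a' n" "\<forall>n>k. b n = b' n"
      by (auto simp: eqF_rel_def eqF_def)
    then have "\<forall>n>max m k. a n + b n = a' n + b' n" by auto
    then have "((\<lambda>n. a n + b n), (\<lambda>n. a' n + b' n)) \<in> eqF_rel"
      unfolding eqF_rel_def eqF_def by blast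
    then show "eqF_rel `` {\<lambda>n. a n + b n} = eqF_rel `` {\<lambda>n. a' n + b' n}"
      by (rule equiv_class_eq[OF equiv_eqF_rel])
  qed
qed auto

lemma class_mult_class:
  "class_mult (eqF_rel `` {a}) (eqF_rel `` {b}) = eqF_rel `` {\<lambda>n. a n * b n}"
  unfolding class_mult_def
proof (rule UN_equiv_class2[OF equiv_eqF_rel equiv_eqF_rel])
  show "congruent2 eqF_rel eqF_rel (\<lambda>a b. eqF_rel `` {\<lambda>n. a n * b n})"
  proof (rule congruent2I')
    fix a a' b b' assume "(a, a') \<in> eqF_rel" "(b, b') \<in> eqF_rel"
    then obtain m k where "\<forall>n>m. a n = a' n" "\<forall>n>k. b n = b' n"
      by (auto simp: eqF_rel_def eqF_def)
    then have "\<forall>n>max m k. a n * b n = a' n * b' n" by auto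
    then have "((\<lambda>n. a n * b n), (\<lambda>n. a' n * b' n)) \<in> eqF_rel"
      unfolding eqF_rel_def eqF_def by blast
    then show "eqF_rel `` {\<lambda>n. a n * b n} = eqF_rel `` {\<lambda>n. a' n * b' n}"
      by (rule equiv_class_eq[OF equiv_eqF_rel])
  qed
qed auto

lemma class_less_class: "class_less (eqF_rel `` {a}) (eqF_rel `` {b}) \<longleftrightarrow> a <\<^sub>F b"
proof
  assume "class_less (eqF_rel `` {a}) (eqF_rel `` {b})"
  then obtain a' b' where "a =\<^sub>F a'" "b =\<^sub>F b'" "a' <\<^sub>F b'"
    by (auto simp: class_less_def eqF_rel_def)
  then obtain m k l where "\<forall>n>m. a n = a' n" "\<forall>n>k. b n = b' n" "\<forall>n>l. a' n < b' n"
    by (auto simp: eqF_def lessF_def)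
  then have "\<forall>n>max m (max k l). a n < b n" by auto
  then show "a <\<^sub>F b" unfolding lessF_def by blast
next
  assume "a <\<^sub>F b"
  then show "class_less (eqF_rel `` {a}) (eqF_rel `` {b})"
    by (auto simp: class_less_def eqF_rel_def eqF_def)
qed

definition poly_seq_ring :: "(nat \<Rightarrow> real) set ring"
  where "poly_seq_ring =
    \<lparr>carrier = poly_seqs // eqF_rel,
     monoid.mult = class_mult, one = eqF_rel `` {\<lambda>n. 1},
     zero = eqF_rel `` {\<lambda>n. 0}, add = class_add\<rparr>"

locale linearly_ordered_domain = domain R for R (structure) +
  fixes lt :: "'a \<Rightarrow> 'a \<Rightarrow> bool" (infix "\<prec>" 50)
  assumes less_irrefl: "x \<in> carrier R \<Longrightarrow> \<not> x \<prec> x"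
    and less_trans: "\<lbrakk>x \<in> carrier R; y \<in> carrier R; z \<in> carrier R; x \<prec> y; y \<prec> z\<rbrakk> \<Longrightarrow> x \<prec> z"
    and less_total: "\<lbrakk>x \<in> carrier R; y \<in> carrier R\<rbrakk> \<Longrightarrow> x \<prec> y \<or> x = y \<or> y \<prec> x"
    and add_less_mono:
      "\<lbrakk>x \<in> carrier R; y \<in> carrier R; z \<in> carrier R; x \<prec> y\<rbrakk> \<Longrightarrow> x \<oplus> z \<prec> y \<oplus> z"
    and mult_less_mono:
      "\<lbrakk>x \<in> carrier R; y \<in> carrier R; z \<in> carrier R; x \<prec> y; \<zero> \<prec> z\<rbrakk> \<Longrightarrow> x \<otimes> z \<prec> y \<otimes> z"

definition non_archimedean :: "('a, 'm) ring_scheme \<Rightarrow> ('a \<Rightarrow> 'a \<Rightarrow> bool) \<Rightarrow> bool"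
  where "non_archimedean R lt \<longleftrightarrow>
    (\<exists>a\<in>carrier R. \<exists>b\<in>carrier R. lt \<zero>\<^bsub>R\<^esub> a \<and> (\<forall>k :: nat. lt ([k] \<cdot>\<^bsub>R\<^esub> a) b))"

end

theory Submission
  imports Defs
begin

text \<open>
  Evaluation at the natural numbers is an isomorphism from the ordered integral domain
  \<open>\<real>[X]\<close>, ordered by the sign of the leading coefficient, onto the polynomial sequences:
  a polynomial with positive leading coefficient is eventually positive. The classes of \<open>1\<close>
  and \<open>X\<close> witness that the order is non-Archimedean.
\<close>

definition poly_class :: "real poly \<Rightarrow> (nat \<Rightarrow> real) set"
  where "poly_class p = eqF_rel `` {\<lambda>n. poly p (real n)}"

text \<open>The order on \<open>real poly\<close> compares by the leading coefficient of the
  difference, and a polynomial with positive leading coefficient eventually stays at or above that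
  coefficient.\<close>

lemma poly_less_imp_lessF:
  assumes "p < q"
  shows "(\<lambda>n. poly p (real n)) <\<^sub>F (\<lambda>n. poly q (real n))"
proof -
  have pos: "lead_coeff (q - p) > 0"
    using assms by (simp add: less_poly_def pos_poly_def)
  then obtain x where "\<forall>y\<ge>x. poly (q - p) y \<ge> lead_coeff (q - p)"
    using poly_pinfty_gt_lc by blast
  \<comment> \<open>The real threshold becomes an index by the Archimedean property of the
    reals.\<close>
  moreover obtain m where "x \<le> real m"
    using real_arch_simple by blast
  ultimately have "\<forall>n>m. poly p (real n) < poly q (real n)"
    using pos by (smt (verit) of_nat_less_iff poly_diff)
  then show ?thesis
    unfolding lessF_def by blast
qed

lemma lessF_asym: "a <\<^sub>F b \<Longrightarrow> \<not> b <\<^sub>F a"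
proof
  assume "a <\<^sub>F b" "b <\<^sub>F a"
  then obtain m k where "\<forall>n>m. a n < b n" "\<forall>n>k. b n < a n"
    by (auto simp: lessF_def)
  then have "a (Suc (max m k)) < b (Suc (max m k))" "b (Suc (max m k)) < a (Suc (max m k))"
    by auto
  then show False
    by simp
qed

text \<open>The converse follows from totality on \<open>real poly\<close>: \<open>p = q\<close>
  contradicts irreflexivity of \<open><\<^sub>F\<close>, and \<open>q < p\<close> contradicts its
  asymmetry.\<close>

lemma class_less_poly_class: "class_less (poly_class p) (poly_class q) \<longleftrightarrow> p < q"
proof -
  have "\<not> (\<lambda>n. poly p (real n)) <\<^sub>F (\<lambda>n. poly p (real n))"
    using lessF_asym by blast
  then show ?thesis
    unfolding poly_class_def class_less_class
    by (metis linorder_neqE poly_less_imp_lessF lessF_asym)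
qed

text \<open>Distinct polynomials are comparable, so equal classes would put a polynomial strictly
  below itself.\<close>

lemma poly_class_eq_iff: "poly_class p = poly_class q \<longleftrightarrow> p = q"
  by (metis class_less_poly_class less_irrefl linorder_neqE)

lemma carrier_poly_seq_ring: "carrier poly_seq_ring = range poly_class"
  by (auto simp: poly_seq_ring_def poly_seqs_def quotient_def poly_class_def)

lemma add_poly_class: "poly_class p \<oplus>\<^bsub>poly_seq_ring\<^esub> poly_class q = poly_class (p + q)"
  by (simp add: poly_seq_ring_def poly_class_def class_add_class)

lemma mult_poly_class: "poly_class p \<otimes>\<^bsub>poly_seq_ring\<^esub> poly_class q = poly_class (p * q)"
  by (simp add: poly_seq_ring_def poly_class_def class_mult_class)

lemma zero_poly_class: "\<zero>\<^bsub>poly_seq_ring\<^esub> = poly_class 0"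
  by (simp add: poly_seq_ring_def poly_class_def)

lemma one_poly_class: "\<one>\<^bsub>poly_seq_ring\<^esub> = poly_class 1"
  by (simp add: poly_seq_ring_def poly_class_def)

text \<open>With injectivity of \<open>poly_class\<close>, these rules turn each ring axiom for
  classes into the same law for \<open>real poly\<close>.\<close>

lemmas poly_class_ring_simps =
  carrier_poly_seq_ring add_poly_class mult_poly_class zero_poly_class one_poly_class

lemma add_pow_poly_class: "[k] \<cdot>\<^bsub>poly_seq_ring\<^esub> poly_class p = poly_class (of_nat k * p)"
  for k :: nat
  by (induction k) (simp_all add: add_pow_def nat_pow_def poly_class_ring_simps algebra_simps)

lemma abelian_group_poly_seq_ring: "abelian_group poly_seq_ring"
proof (rule abelian_groupI; (unfold carrier_poly_seq_ring)?; (elim rangeE)?)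
  fix x p assume "x = poly_class p"
  then have "poly_class (- p) \<oplus>\<^bsub>poly_seq_ring\<^esub> x = \<zero>\<^bsub>poly_seq_ring\<^esub>"
    by (simp add: poly_class_ring_simps)
  then show "\<exists>y\<in>range poly_class. y \<oplus>\<^bsub>poly_seq_ring\<^esub> x = \<zero>\<^bsub>poly_seq_ring\<^esub>"
    by blast
qed (simp_all add: poly_class_ring_simps poly_class_eq_iff)

lemma comm_monoid_poly_seq_ring: "Group.comm_monoid poly_seq_ring"
  by (rule comm_monoidI; (unfold carrier_poly_seq_ring)?; (elim rangeE)?)
    (simp_all add: poly_class_ring_simps poly_class_eq_iff)

lemma cring_poly_seq_ring: "cring poly_seq_ring"
  by (rule cringI[OF abelian_group_poly_seq_ring comm_monoid_poly_seq_ring];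
      (unfold carrier_poly_seq_ring)?; (elim rangeE)?)
    (simp_all add: poly_class_ring_simps poly_class_eq_iff distrib_right)

text \<open>A product of classes that is zero comes from a product of polynomials that is zero, and
  \<open>real poly\<close> has no zero divisors.\<close>

lemma domain_poly_seq_ring: "domain poly_seq_ring"
  by (intro domain.intro domain_axioms.intro cring_poly_seq_ring;
      (unfold carrier_poly_seq_ring)?; (elim rangeE)?)
    (simp_all add: poly_class_ring_simps poly_class_eq_iff)

lemma linearly_ordered_domain_poly_seq_ring: "linearly_ordered_domain poly_seq_ring class_less"
  by (intro linearly_ordered_domain.intro linearly_ordered_domain_axioms.intro
        domain_poly_seq_ring;
      (unfold carrier_poly_seq_ring)?; (elim rangeE)?)
    (simp_all add: poly_class_ring_simps class_less_poly_class poly_class_eq_iff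
      less_linear mult_strict_right_mono)

text \<open>The difference X - k has leading coefficient 1 for every k.\<close>

lemma of_nat_less_monom_one: "of_nat k < (monom 1 1 :: real poly)"
  by (simp add: less_poly_def pos_poly_def of_nat_poly monom_altdef)

lemma non_archimedean_poly_seq_ring: "non_archimedean poly_seq_ring class_less"
proof -
  have "class_less \<zero>\<^bsub>poly_seq_ring\<^esub> (poly_class 1)"
    by (simp add: zero_poly_class class_less_poly_class)
  moreover have "class_less ([k] \<cdot>\<^bsub>poly_seq_ring\<^esub> poly_class 1) (poly_class (monom 1 1))"
    for k :: nat
    \<comment> \<open>Without the deletion the exponent in \<open>monom 1 1\<close> would turn into
      \<open>Suc 0\<close> and no longer match.\<close>
    by (simp add: add_pow_poly_class class_less_poly_class of_nat_less_monom_one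
        del: One_nat_def)
  ultimately show ?thesis
    unfolding non_archimedean_def carrier_poly_seq_ring by blast
qed

theorem theorem7:
  "linearly_ordered_domain poly_seq_ring class_less \<and> non_archimedean poly_seq_ring class_less"
  using linearly_ordered_domain_poly_seq_ring non_archimedean_poly_seq_ring by blast

end
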